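(* Let $s\ge2$, $h$, $t$ be positive integers with $t\mid h$ and $s\le h$, and let $q=2^h$. Assume that $\mathbb{F}_q$ is the splitting field of $g(x)=x^{2^s}+ax^{2^s-1}+bx^{2^s-2}+a^3x^{2^s-3}+c\in\mathbb{F}_{2^t}[x]$ with $a,b,c\neq0$, that $\alpha_1,\dots,\alpha_{2^s}$ are all the roots of $g(x)$ and are pairwise distinct, and let $v_i=(a^{2^{h-1}}\alpha_i^{2^{s-1}-1}+a^{3\cdot2^{h-1}}\alpha_i^{2^{s-1}-2})^{-1}$ for $1\le i\le2^s$. Let $\boldsymbol{\alpha}=(\alpha_1,\dots,\alpha_{2^s})$ and $\boldsymbol{v}=(v_1,\dots,v_{2^s})$. Let $\eta_1\in\mathbb{F}_q^*$ and $\eta_2=a\eta_1$. Set $$\mathcal{S}_1=\Big\{\sum_{i=0}^{2^{s-1}-1}f_ix^i+(f_{2^{s-1}-2}+af_{2^{s-1}-1})\,\eta_1x^{2^{s-1}+1}: f_i\in\mathbb{F}_q\text{ for }0\le i\le2^{s-1}-1\Big\}.$$ Then $\mathcal{C}_1=ev_{\boldsymbol{\alpha},\boldsymbol{v}}(\mathcal{S}_1)$ is a $[2^s,\,2^{s-1},\,\ge2^{s-1}-1]$ self-dual TGRS code over $\mathbb{F}_q$.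
   Context: For $\boldsymbol{\alpha}\in\mathbb{F}^n$ with distinct entries and $\boldsymbol{v}\in(\mathbb{F}^* )^n$ ($\mathbb{F}$ a finite field), $ev_{\boldsymbol{\alpha},\boldsymbol{v}}(f)=(v_1f(\alpha_1),\dots,v_nf(\alpha_n))$ for $f\in\mathbb{F}[x]$. For a $k\times(n-k)$ matrix $(\eta_{ij})$ over $\mathbb{F}$, the twisted generalized Reed-Solomon (TGRS) code is the image under $ev_{\boldsymbol{\alpha},\boldsymbol{v}}$ of $\{\sum_{i=0}^{k-1}f_ix^i+\sum_{i=0}^{k-1}f_i\sum_{j=1}^{n-k}\eta_{i+1,j}x^{k-1+j}:f_i\in\mathbb{F}\}$. A linear code is $[n,k,\ge d]$ if it has length $n$, dimension $k$ and minimum Hamming distance at least $d$. It is self-dual if $\mathcal{C}=\mathcal{C}^\perp$ for the Euclidean inner product. *)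

theory Defs
  imports "HOL-Analysis.Analysis" "HOL-Computational_Algebra.Polynomial" "HOL-Computational_Algebra.Primes"
begin

(* inverse 0 = 0, so the closure condition under inverses needs no side condition. *)
definition is_subfield :: "'a::field set \<Rightarrow> bool" where
  "is_subfield K \<longleftrightarrow>
     0 \<in> K \<and> 1 \<in> K \<and>
     (\<forall>x\<in>K. \<forall>y\<in>K. x - y \<in> K \<and> x * y \<in> K) \<and> (\<forall>x\<in>K. inverse x \<in> K)"

(* The whole type 'a is the splitting field of p over its subfield K. *)
definition splitting_field_over :: "'a::field set \<Rightarrow> 'a poly \<Rightarrow> bool" where
  "splitting_field_over K p \<longleftrightarrow>
     is_subfield K \<and> p \<noteq> 0 \<and> (\<forall>i. coeff p i \<in> K) \<and>
     (\<exists>rs. p = smult (lead_coeff p) (\<Prod>r\<leftarrow>rs. [:- r, 1:])) \<and>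
     (\<forall>L. is_subfield L \<and> K \<subseteq> L \<and> {x. poly p x = 0} \<subseteq> L \<longrightarrow> L = UNIV)"

(* Words of length n are vectors 'a ^ 'n with CARD('n) = n. *)

definition hamming_dist :: "'a ^ 'n \<Rightarrow> 'a ^ 'n \<Rightarrow> nat" where
  "hamming_dist x y = card {i. x $ i \<noteq> y $ i}"

(* Equals 0 for a code with a single word, as Inf {} = (0::nat). *)
definition min_dist :: "('a ^ 'n) set \<Rightarrow> nat" where
  "min_dist C = Inf {hamming_dist x y | x y. x \<in> C \<and> y \<in> C \<and> x \<noteq> y}"

definition linear_code :: "('a::field ^ 'n) set \<Rightarrow> nat \<Rightarrow> nat \<Rightarrow> nat \<Rightarrow> bool" where
  "linear_code C n k d \<longleftrightarrow>
     vec.subspace C \<and> CARD('n) = n \<and> vec.dim C = k \<and> d \<le> min_dist C"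

definition dual_code :: "('a::field ^ 'n) set \<Rightarrow> ('a ^ 'n) set" where
  "dual_code C = {x. \<forall>y\<in>C. scalar_product x y = 0}"

definition self_dual :: "('a::field ^ 'n) set \<Rightarrow> bool" where
  "self_dual C \<longleftrightarrow> C = dual_code C"

definition ev :: "'a::field ^ 'n \<Rightarrow> 'a ^ 'n \<Rightarrow> 'a poly \<Rightarrow> 'a ^ 'n" where
  "ev \<alpha> v f = (\<chi> i. v $ i * poly f (\<alpha> $ i))"

(* Only the entries \<eta> i j with 1 \<le> i \<le> k and 1 \<le> j \<le> n - k are used. *)
definition tgrs_polys :: "nat \<Rightarrow> nat \<Rightarrow> (nat \<Rightarrow> nat \<Rightarrow> 'a::field) \<Rightarrow> 'a poly set" where
  "tgrs_polys n k \<eta> =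
     {(\<Sum>i<k. monom (f i) i) + (\<Sum>i<k. smult (f i) (\<Sum>j=1..n-k. monom (\<eta> (i+1) j) (k-1+j)))
       | f. True}"

definition is_tgrs_code :: "nat \<Rightarrow> 'a::field ^ 'n \<Rightarrow> 'a ^ 'n \<Rightarrow> ('a ^ 'n) set \<Rightarrow> bool" where
  "is_tgrs_code k \<alpha> v C \<longleftrightarrow>
     inj (($) \<alpha>) \<and> (\<forall>i. v $ i \<noteq> 0) \<and> 1 \<le> k \<and> k < CARD('n) \<and>
     (\<exists>\<eta>. C = ev \<alpha> v ` tgrs_polys (CARD('n)) k \<eta>)"

end

theory Submission
  imports Defs
begin

text \<open>
  In characteristic 2 the square of \<open>v\<^sub>i\<close> is \<open>1 / g'(\<alpha>\<^sub>i)\<close>, so the inner product of the words of \<open>p\<close> and \<open>q\<close>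
  is \<open>L (p q)\<close> with \<open>L p = (\<Sum>i. p(\<alpha>\<^sub>i) / g'(\<alpha>\<^sub>i))\<close>. By Lagrange interpolation, \<open>L\<close> is the coefficient at
  \<open>x\<^bsup>n-1\<^esup>\<close> of the remainder modulo \<open>g\<close>. Hence \<open>L (x\<^sup>m) = 0\<close> for \<open>m < n - 1\<close>, \<open>L (x\<^bsup>n-1\<^esup>) = 1\<close> and \<open>L (x\<^sup>n) = a\<close>,
  while the coefficient \<open>a\<^sup>3\<close> in \<open>g\<close> is chosen so that \<open>L (x\<^bsup>n+2\<^esup>) = 0\<close>. These values give both
  self-orthogonality and, by comparing coefficients, the inclusion of the dual code in the code.
\<close>

section \<open>Lagrange interpolation and monic polynomials with simple roots\<close>

definition lagrange :: "'a::field set \<Rightarrow> ('a \<Rightarrow> 'a) \<Rightarrow> 'a poly" where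
  "lagrange A w =
     (\<Sum>x\<in>A. smult (w x / (\<Prod>y\<in>A-{x}. x - y)) (\<Prod>y\<in>A-{x}. [:-y, 1:]))"

lemma degree_prod_linear: "degree (\<Prod>y\<in>A. [:-y, 1::'a::field:]) = card A"
  by (subst degree_prod_eq_sum_degree) auto

lemma coeff_prod_linear: "coeff (\<Prod>y\<in>A. [:-y, 1::'a::field:]) (card A) = 1"
  using lead_coeff_prod[of "\<lambda>y. [:-y, 1:]" A] by (simp add: degree_prod_linear)

lemma degree_lagrange:
  assumes "finite A" "A \<noteq> {}"
  shows "degree (lagrange A w) < card A"
proof -
  have "degree (lagrange A w) \<le> card A - 1"
    unfolding lagrange_def
  proof (rule degree_sum_le[OF assms(1)])
    fix x assume "x \<in> A"
    then show "degree (smult (w x / (\<Prod>y\<in>A-{x}. x - y)) (\<Prod>y\<in>A-{x}. [:-y, 1:])) \<le> card A - 1"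
      by (intro order_trans[OF degree_smult_le]) (simp add: degree_prod_linear)
  qed
  moreover have "card A > 0" using assms by (simp add: card_gt_0_iff)
  ultimately show ?thesis by linarith
qed

lemma coeff_lagrange:
  "coeff (lagrange A w) (card A - 1) = (\<Sum>x\<in>A. w x / (\<Prod>y\<in>A-{x}. x - y))"
  unfolding lagrange_def coeff_sum
proof (rule sum.cong)
  fix x assume "x \<in> A"
  then show "coeff (smult (w x / (\<Prod>y\<in>A-{x}. x - y)) (\<Prod>y\<in>A-{x}. [:-y, 1:])) (card A - 1)
      = w x / (\<Prod>y\<in>A-{x}. x - y)"
    using coeff_prod_linear[of "A - {x}"] by simp
qed simp

lemma poly_lagrange:
  assumes "finite A" "z \<in> A"
  shows "poly (lagrange A w) z = w z"
proof -
  have "poly (lagrange A w) z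
      = (\<Sum>x\<in>A. w x / (\<Prod>y\<in>A-{x}. x - y) * (\<Prod>y\<in>A-{x}. z - y))"
    by (simp add: lagrange_def poly_sum poly_prod)
  also have "\<dots> = (\<Sum>x\<in>A. if x = z then w z else 0)"
    using assms by (intro sum.cong) auto
  finally show ?thesis using assms by simp
qed

text \<open>A polynomial of degree below \<open>card A\<close> is its own interpolant on
  \<open>A\<close>; the sum is the coefficient of that interpolant at \<open>card A - 1\<close>,
  because the node products are monic of that degree.\<close>

lemma sum_poly_over_roots:
  fixes p :: "'a::field poly"
  assumes "finite A" "degree p < card A"
  shows "(\<Sum>x\<in>A. poly p x / (\<Prod>y\<in>A-{x}. x - y)) = coeff p (card A - 1)"
proof -
  have "A \<noteq> {}" using assms by auto
  have "lagrange A (poly p) = p"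
    by (rule poly_eqI_degree[where A = A])
      (use assms \<open>A \<noteq> {}\<close> in \<open>simp_all add: poly_lagrange degree_lagrange\<close>)
  then show ?thesis using coeff_lagrange[of A "poly p"] by simp
qed

text \<open>Both sides are monic of degree \<open>degree g\<close> and agree at
  \<open>degree g\<close> points, so they coincide.\<close>

lemma monic_eq_prod_roots:
  fixes g :: "'a::field poly"
  assumes "lead_coeff g = 1" "card {x. poly g x = 0} = degree g"
  shows "g = (\<Prod>x\<in>{x. poly g x = 0}. [:-x, 1:])"
proof (rule poly_eqI_degree_lead_coeff[where A = "{x. poly g x = 0}" and n = "degree g"])
  have fin: "finite {x. poly g x = 0}" using assms by (intro poly_roots_finite) auto
  show "coeff g (degree g) = coeff (\<Prod>x\<in>{x. poly g x = 0}. [:-x, 1:]) (degree g)"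
    using assms(1) coeff_prod_linear[of "{x. poly g x = 0}"] unfolding assms(2) by simp
  show "degree (\<Prod>x\<in>{x. poly g x = 0}. [:-x, 1:]) \<le> degree g"
    by (simp add: degree_prod_linear assms)
  fix z assume "z \<in> {x. poly g x = 0}"
  then show "poly g z = poly (\<Prod>x\<in>{x. poly g x = 0}. [:-x, 1:]) z"
    using fin by (auto simp: poly_prod)
qed (use assms in auto)

text \<open>In the product rule every summand that keeps the factor x - z vanishes at z. This turns
  the Lagrange denominators into values of the derivative.\<close>

lemma poly_pderiv_prod_linear:
  fixes z :: "'a::field"
  assumes "finite A" "z \<in> A"
  shows "poly (pderiv (\<Prod>x\<in>A. [:-x, 1:])) z = (\<Prod>y\<in>A-{z}. z - y)"
proof -
  have "poly (pderiv (\<Prod>x\<in>A. [:-x, 1:])) z = (\<Sum>x\<in>A. \<Prod>y\<in>A-{x}. z - y)"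
    by (simp add: pderiv_prod poly_sum poly_prod pderiv_pCons)
  also have "\<dots> = (\<Sum>x\<in>A. if x = z then (\<Prod>y\<in>A-{z}. z - y) else 0)"
    using assms by (intro sum.cong) auto
  finally show ?thesis using assms by simp
qed

lemma poly_pderiv_root_nonzero:
  fixes g :: "'a::field poly"
  assumes "lead_coeff g = 1" "card {x. poly g x = 0} = degree g" "poly g z = 0"
  shows "poly (pderiv g) z \<noteq> 0"
proof -
  have fin: "finite {x. poly g x = 0}" using assms by (intro poly_roots_finite) auto
  then show ?thesis
    using poly_pderiv_prod_linear[of "{x. poly g x = 0}" z] assms(3)
    by (subst monic_eq_prod_roots[OF assms(1,2)]) auto
qed

section \<open>Dimension and minimum distance of evaluation codes\<close>

text \<open>Independence is stated for the indexed family, so it also excludes repetitions and the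
  dimension counts indices.\<close>

lemma dim_span_family:
  fixes w :: "nat \<Rightarrow> 'a::field ^ 'n"
  assumes indep: "\<And>f j. (\<Sum>i<k. f i *s w i) = 0 \<Longrightarrow> j < k \<Longrightarrow> f j = 0"
  defines "V \<equiv> {\<Sum>i<k. f i *s w i |f. True}"
  shows "vec.subspace V" "vec.dim V = k"
proof -
  have inj: "inj_on w {..<k}"
  proof (rule inj_onI, rule ccontr)
    fix i j assume ij: "i \<in> {..<k}" "j \<in> {..<k}" "w i = w j" "i \<noteq> j"
    \<comment> \<open>A repetition would yield the nontrivial relation with coefficients 1 and
      -1.\<close>
    define f where "f l = (if l = i then 1 else if l = j then -1 else (0::'a))" for l
    have "(\<Sum>l<k. f l *s w l) = (\<Sum>l\<in>{i,j}. f l *s w l)"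
      by (rule sum.mono_neutral_right) (use ij in \<open>auto simp: f_def\<close>)
    also have "\<dots> = 0" using ij by (simp add: f_def)
    finally have "f i = 0" by (rule indep) (use ij in simp)
    then show False by (simp add: f_def)
  qed
  have ind: "vec.independent (w ` {..<k})"
  proof (rule vec.independent_if_scalars_zero)
    fix f x assume "(\<Sum>x\<in>w ` {..<k}. f x *s x) = 0" "x \<in> w ` {..<k}"
    then show "f x = 0" using indep[of "\<lambda>i. f (w i)"] inj by (auto simp: sum.reindex)
  qed simp
  have "V = vec.span (w ` {..<k})"
  proof
    show "V \<subseteq> vec.span (w ` {..<k})"
      unfolding V_def by (auto intro!: vec.span_sum vec.span_scale intro: vec.span_base)
    show "vec.span (w ` {..<k}) \<subseteq> V"
      by (auto simp: vec.span_finite V_def sum.reindex[OF inj])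
  qed
  then show "vec.subspace V" "vec.dim V = k"
    using ind inj by (simp_all add: vec.dim_eq_card_independent card_image)
qed

lemma ev_sum_smult:
  "ev \<alpha> v (\<Sum>i\<in>I. smult (f i) (e i)) = (\<Sum>i\<in>I. f i *s ev \<alpha> v (e i))"
  by (simp add: ev_def vec_eq_iff sum_component poly_sum sum_distrib_left mult.left_commute)

text \<open>The two words agree exactly at the positions where \<open>p - q\<close> has a root, and
  distinct positions give distinct roots.\<close>

lemma hamming_dist_ev:
  fixes \<alpha> v :: "'a::field ^ 'n"
  assumes "inj (($) \<alpha>)" "\<And>i. v $ i \<noteq> 0" "p \<noteq> q" "degree p \<le> d" "degree q \<le> d"
  shows "CARD('n) - d \<le> hamming_dist (ev \<alpha> v p) (ev \<alpha> v q)"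
proof -
  let ?Z = "{i. poly (p - q) (\<alpha> $ i) = 0}"
  have "card ?Z = card ((($) \<alpha>) ` ?Z)"
    by (rule card_image[symmetric]) (rule inj_on_subset[OF assms(1)], simp)
  also have "\<dots> \<le> card {x. poly (p - q) x = 0}"
    by (rule card_mono[OF poly_roots_finite]) (use assms in auto)
  also have "\<dots> \<le> degree (p - q)" using assms by (intro card_poly_roots_bound) auto
  also have "\<dots> \<le> d" using assms by (intro degree_diff_le)
  finally have "card ?Z \<le> d" .
  moreover have "hamming_dist (ev \<alpha> v p) (ev \<alpha> v q) = card (UNIV - ?Z)"
    unfolding hamming_dist_def by (rule arg_cong[where f = card]) (use assms in \<open>auto simp: ev_def\<close>)
  ultimately show ?thesis by (simp add: card_Diff_subset)
qed

lemma min_dist_geI: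
  assumes "x \<in> C" "y \<in> C" "x \<noteq> y"
    and "\<And>x y. x \<in> C \<Longrightarrow> y \<in> C \<Longrightarrow> x \<noteq> y \<Longrightarrow> d \<le> hamming_dist x y"
  shows "d \<le> min_dist C"
  unfolding min_dist_def
proof (rule cInf_greatest)
  show "{hamming_dist x y |x y. x \<in> C \<and> y \<in> C \<and> x \<noteq> y} \<noteq> {}" using assms(1-3) by blast
qed (use assms(4) in blast)

section \<open>Weighted root sums and interpolation of words\<close>

definition root_sum :: "'a::field ^ 'n \<Rightarrow> 'a ^ 'n \<Rightarrow> 'a poly \<Rightarrow> 'a" where
  "root_sum \<alpha> v p = (\<Sum>i\<in>UNIV. (v $ i)\<^sup>2 * poly p (\<alpha> $ i))"

lemma scalar_product_ev: "scalar_product (ev \<alpha> v p) (ev \<alpha> v q) = root_sum \<alpha> v (p * q)"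
  by (simp add: scalar_product_def ev_def root_sum_def power2_eq_square mult_ac)

lemma root_sum_add: "root_sum \<alpha> v (p + q) = root_sum \<alpha> v p + root_sum \<alpha> v q"
  by (simp add: root_sum_def algebra_simps sum.distrib)

lemma root_sum_smult: "root_sum \<alpha> v (smult r p) = r * root_sum \<alpha> v p"
  by (simp add: root_sum_def sum_distrib_left mult.left_commute)

lemma root_sum_monom: "root_sum \<alpha> v (monom r m) = r * root_sum \<alpha> v (monom 1 m)"
  using root_sum_smult[of \<alpha> v r "monom 1 m"] by (simp add: smult_monom)

text \<open>The weights are the reciprocal Lagrange denominators at the roots of \<open>g\<close>,
  which \<alpha> enumerates without repetition, so \<open>sum_poly_over_roots\<close>
  applies.\<close>

lemma root_sum_eq_coeff:
  fixes \<alpha> v :: "'a::field ^ 'n"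
  assumes "inj (($) \<alpha>)" "range (($) \<alpha>) = {x. poly g x = 0}"
    and "lead_coeff g = 1" "degree g = CARD('n)"
    and v: "\<And>i. (v $ i)\<^sup>2 = inverse (poly (pderiv g) (\<alpha> $ i))"
    and "degree p < CARD('n)"
  shows "root_sum \<alpha> v p = coeff p (CARD('n) - 1)"
proof -
  let ?A = "range (($) \<alpha>)"
  have card: "card ?A = CARD('n)" using assms(1) by (rule card_image)
  have g: "g = (\<Prod>x\<in>?A. [:-x, 1:])"
    using monic_eq_prod_roots[of g] assms card by simp
  have "root_sum \<alpha> v p = (\<Sum>i\<in>UNIV. poly p (\<alpha> $ i) / (\<Prod>y\<in>?A-{\<alpha> $ i}. \<alpha> $ i - y))"
    unfolding root_sum_def v by (subst g, subst poly_pderiv_prod_linear) (auto simp: field_simps)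
  also have "\<dots> = (\<Sum>x\<in>?A. poly p x / (\<Prod>y\<in>?A-{x}. x - y))"
    by (simp add: sum.reindex[OF assms(1)] o_def)
  finally show ?thesis using sum_poly_over_roots[of ?A p] assms(6) card by simp
qed

text \<open>Interpolate the values \<open>x $ i / v $ i\<close> at the points
  \<open>\<alpha> $ i\<close>.\<close>

lemma ev_surj:
  fixes \<alpha> v :: "'a::field ^ 'n"
  assumes "inj (($) \<alpha>)" "\<And>i. v $ i \<noteq> 0"
  obtains p where "degree p < CARD('n)" "x = ev \<alpha> v p"
proof
  let ?p = "lagrange (range (($) \<alpha>)) (\<lambda>z. x $ (inv (($) \<alpha>) z) / v $ (inv (($) \<alpha>) z))"
  show "degree ?p < CARD('n)"
    using degree_lagrange[of "range (($) \<alpha>)"] card_image[OF assms(1)] by simp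
  show "x = ev \<alpha> v ?p"
    using assms by (simp add: ev_def vec_eq_iff poly_lagrange)
qed

lemma ev_eq_iff:
  fixes \<alpha> v :: "'a::field ^ 'n"
  assumes "inj (($) \<alpha>)" "\<And>i. v $ i \<noteq> 0" "degree p < CARD('n)" "degree q < CARD('n)"
  shows "ev \<alpha> v p = ev \<alpha> v q \<longleftrightarrow> p = q"
proof
  assume "ev \<alpha> v p = ev \<alpha> v q"
  then show "p = q"
    using assms card_image[OF assms(1)]
    by (intro poly_eqI_degree[where A = "range (($) \<alpha>)"]) (auto simp: ev_def vec_eq_iff)
qed simp

section \<open>Twisted monomials\<close>

text \<open>The coefficient of \<open>f i\<close> in the linear form
  \<open>f m + a * f (m + 1)\<close>. By \<open>L_twist\<close> it is also the value of the
  functional at \<open>x^(i + m + 3)\<close>, and this coincidence drives the duality.\<close>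

definition twist :: "nat \<Rightarrow> 'a::field \<Rightarrow> nat \<Rightarrow> 'a" where
  "twist m a i = (if i = m then 1 else if i = m + 1 then a else 0)"

text \<open>With \<open>k = m + 2\<close>, the twisted monomials for \<open>i < k\<close> form a basis of \<open>\<S>\<^sub>1\<close>.\<close>

definition tmonom :: "nat \<Rightarrow> 'a::field \<Rightarrow> 'a \<Rightarrow> nat \<Rightarrow> 'a poly" where
  "tmonom m a \<eta> i = monom 1 i + monom (twist m a i * \<eta>) (m + 3)"

lemma degree_tmonom: "i < m + 2 \<Longrightarrow> degree (tmonom m a \<eta> i) \<le> m + 3"
  unfolding tmonom_def by (intro degree_add_le order_trans[OF degree_monom_le]) auto

lemma degree_sum_tmonom: "degree (\<Sum>i<m+2. smult (f i) (tmonom m a \<eta> i)) \<le> m + 3"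
  by (intro degree_sum_le order_trans[OF degree_smult_le] degree_tmonom) auto

lemma sum_tmonom:
  "(\<Sum>i<m+2. smult (f i) (tmonom m a \<eta> i))
     = (\<Sum>i<m+2. monom (f i) i) + monom ((f m + a * f (m + 1)) * \<eta>) (m + 3)"
proof -
  have "(\<Sum>i<m+2. smult (f i) (tmonom m a \<eta> i))
      = (\<Sum>i<m+2. monom (f i) i) + (\<Sum>i<m+2. monom (f i * (twist m a i * \<eta>)) (m + 3))"
    by (simp add: tmonom_def smult_add_right smult_monom sum.distrib)
  also have "(\<Sum>i<m+2. monom (f i * (twist m a i * \<eta>)) (m + 3))
      = monom (\<Sum>i<m+2. f i * (twist m a i * \<eta>)) (m + 3)"
    by (rule poly_eqI) (simp add: coeff_sum)
  also have "(\<Sum>i<m+2. f i * (twist m a i * \<eta>)) = (f m + a * f (m + 1)) * \<eta>"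
    by (simp add: twist_def algebra_simps)
  finally show ?thesis .
qed

lemma coeff_sum_tmonom:
  assumes "j < m + 2"
  shows "coeff (\<Sum>i<m+2. smult (f i) (tmonom m a \<eta> i)) j = f j"
proof -
  have "coeff (\<Sum>i<m+2. smult (f i) (tmonom m a \<eta> i)) j = (\<Sum>i<m+2. if i = j then f i else 0)"
    using assms unfolding sum_tmonom by (simp add: coeff_sum)
  also have "\<dots> = f j" using assms by (subst sum.delta) auto
  finally show ?thesis .
qed

text \<open>Membership criterion for the twisted space in terms of coefficients; it is the form in
  which words of the dual code are recognised.\<close>

lemma sum_monom_twisted:
  assumes "degree p \<le> m + 3" "coeff p (m + 2) = 0"
    and "coeff p (m + 3) = (coeff p m + a * coeff p (m + 1)) * \<eta>"
  shows "p = (\<Sum>i<m+2. smult (coeff p i) (tmonom m a \<eta> i))"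
proof -
  have "p = (\<Sum>i\<le>m+3. monom (coeff p i) i)"
    using poly_as_sum_of_monoms'[OF assms(1)] by simp
  also have "\<dots> = (\<Sum>i<m+2. monom (coeff p i) i) + monom (coeff p (m + 3)) (m + 3)"
    using assms(2) by (simp add: lessThan_Suc_atMost[symmetric] numeral_3_eq_3)
  finally show ?thesis unfolding sum_tmonom assms(3) .
qed

section \<open>Orthogonality for an abstract functional\<close>

text \<open>\<open>L\<close> will be \<open>root_sum \<alpha> v\<close>, for a code of length \<open>n = 2 * m + 4\<close> and dimension \<open>m + 2\<close>.\<close>

locale twisted_functional =
  fixes L :: "'a::field poly \<Rightarrow> 'a" and m :: nat and a :: 'a
  assumes two: "(2::'a) = 0"
    and L_add: "L (p + q) = L p + L q"
    and L_smult: "L (smult r p) = r * L p"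
    and L_low: "degree p < 2 * m + 4 \<Longrightarrow> L p = coeff p (2 * m + 3)"
    and L_n: "L (monom 1 (2 * m + 4)) = a"
    and L_n2: "L (monom 1 (2 * m + 6)) = 0"
begin

lemma double: "x + x = (0::'a)"
  using two by (metis mult_2 mult_zero_left)

lemma L_sum: "L (\<Sum>i\<in>I. f i) = (\<Sum>i\<in>I. L (f i))"
  by (induction I rule: infinite_finite_induct) (simp_all add: L_add L_low)

lemma L_monom: "L (monom r j) = r * L (monom 1 j)"
  using L_smult[of r "monom 1 j"] by (simp add: smult_monom)

lemma L_small: "j < 2 * m + 3 \<Longrightarrow> L (monom 1 j) = 0"
  by (subst L_low) (auto simp: degree_monom_eq)

lemma L_top: "L (monom 1 (2 * m + 3)) = 1"
  by (subst L_low) (auto simp: degree_monom_eq)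

lemma L_twist:
  assumes "i < m + 2"
  shows "L (monom 1 (i + (m + 3))) = twist m a i"
proof -
  have e: "m + (m + 3) = 2 * m + 3" "m + 1 + (m + 3) = 2 * m + 4" by simp_all
  consider "i < m" | "i = m" | "i = m + 1" using assms by linarith
  then show ?thesis
  proof cases
    case 1
    then show ?thesis by (simp add: twist_def L_small)
  next
    case 2
    show ?thesis unfolding 2 e L_top by (simp add: twist_def)
  next
    case 3
    show ?thesis unfolding 3 e L_n by (simp add: twist_def)
  qed
qed

text \<open>Of the four products, \<open>x^(i + j)\<close> has exponent at most
  \<open>2 * m + 2\<close> and \<open>x^(2 * m + 6)\<close> is killed by \<open>L_n2\<close>. The
  two cross terms are equal by \<open>L_twist\<close> and cancel in characteristic 2.\<close>

lemma tmonom_orthogonal: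
  assumes "i < m + 2" "j < m + 2"
  shows "L (tmonom m a \<eta> i * tmonom m a \<eta> j) = 0"
proof -
  have "tmonom m a \<eta> i * tmonom m a \<eta> j = monom 1 (i + j)
      + (smult (twist m a j * \<eta>) (monom 1 (i + (m + 3))) + smult (twist m a i * \<eta>) (monom 1 (j + (m + 3))))
      + smult (twist m a i * \<eta> * (twist m a j * \<eta>)) (monom 1 (2 * m + 6))"
    unfolding tmonom_def by (simp add: algebra_simps mult_monom smult_monom)
  then have "L (tmonom m a \<eta> i * tmonom m a \<eta> j)
      = L (monom 1 (i + j)) + (twist m a j * \<eta> * twist m a i + twist m a i * \<eta> * twist m a j)"
    using assms by (simp only: L_add L_smult L_twist L_n2 mult_zero_right add_0_right)
  also have "twist m a i * \<eta> * twist m a j = twist m a j * \<eta> * twist m a i" by simp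
  finally show ?thesis using assms by (simp add: L_small double)
qed

lemma L_mult_monom:
  assumes "degree p \<le> m + 3"
  shows "L (p * monom 1 j) = (\<Sum>i\<le>m+3. coeff p i * L (monom 1 (i + j)))"
proof -
  have "p * monom 1 j = (\<Sum>i\<le>m+3. monom (coeff p i) (i + j))"
    by (subst poly_as_sum_of_monoms'[OF assms, symmetric]) (simp add: sum_distrib_right mult_monom)
  then show ?thesis by (simp add: L_sum L_monom[of "coeff p _"])
qed

text \<open>The plain monomials, \<open>j < m\<close>, bound the degree by \<open>m + 3\<close>. The
  two twisted ones then give the two coefficient conditions of
  \<open>sum_monom_twisted\<close>.\<close>

lemma orthogonal_imp_twisted:
  assumes deg: "degree p < 2 * m + 4"
    and orth: "\<And>j. j < m + 2 \<Longrightarrow> L (p * tmonom m a \<eta> j) = 0"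
  shows "p = (\<Sum>i<m+2. smult (coeff p i) (tmonom m a \<eta> i))"
proof -
  have deg': "degree p \<le> m + 3"
  proof (rule ccontr)
    assume hi: "\<not> degree p \<le> m + 3"
    \<comment> \<open>This shift moves the leading term of \<open>p\<close> to degree
      \<open>2 * m + 3\<close>, where \<open>L\<close> reads it off. Since
      \<open>degree p > m + 3\<close>, it satisfies \<open>j < m\<close>, so
      \<open>tmonom m a \<eta> j\<close> is just \<open>x^j\<close>.\<close>
    define j where "j = 2 * m + 3 - degree p"
    have j: "j < m" "j + degree p = 2 * m + 3" using hi deg by (auto simp: j_def)
    have "degree (p * monom 1 j) < 2 * m + 4"
      using degree_mult_le[of p "monom 1 j"] j by (simp add: degree_monom_eq)
    then have "L (p * monom 1 j) = coeff (p * monom 1 j) (2 * m + 3)" by (rule L_low)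
    also have "\<dots> = lead_coeff p"
      using j by (simp add: mult.commute[of p] coeff_monom_mult) (metis add_diff_cancel_left')
    finally have "lead_coeff p = 0"
      using orth[of j] j by (simp add: tmonom_def twist_def)
    then show False using hi by simp
  qed
  have split: "(\<Sum>i\<le>m+3. f i) = (\<Sum>i<m. f i) + f m + f (m + 1) + f (m + 2) + f (m + 3)"
    for f :: "nat \<Rightarrow> 'a"
    by (simp add: lessThan_Suc_atMost[symmetric] numeral_eq_Suc)
  have orth': "L (p * monom 1 j) + twist m a j * \<eta> * L (p * monom 1 (m + 3)) = 0"
    if "j < m + 2" for j
  proof -
    have "p * tmonom m a \<eta> j = p * monom 1 j + smult (twist m a j * \<eta>) (p * monom 1 (m + 3))"
      by (simp add: tmonom_def algebra_simps flip: mult_smult_right) (simp add: smult_monom)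
    then show ?thesis using orth[OF that] by (simp add: L_add L_smult)
  qed
  have e: "m + 3 + m = 2 * m + 3" "m + 2 + (m + 1) = 2 * m + 3" "m + 3 + (m + 1) = 2 * m + 4"
    "m + 3 + (m + 3) = 2 * m + 6" "m + (m + 3) = 2 * m + 3" "m + 1 + (m + 3) = 2 * m + 4"
    by simp_all
  have L1: "L (p * monom 1 m) = coeff p (m + 3)"
    unfolding L_mult_monom[OF deg'] split e L_top by (simp add: L_small)
  have L2: "L (p * monom 1 (m + 1)) = coeff p (m + 2) + a * coeff p (m + 3)"
    unfolding L_mult_monom[OF deg'] split e L_top L_n by (simp add: L_small)
  \<comment> \<open>The twist at \<open>m + 1\<close> is \<open>a\<close> times the twist at
    \<open>m\<close>, so this combination eliminates \<open>L (p * monom 1 (m + 3))\<close>.\<close>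
  have "L (p * monom 1 (m + 1)) - a * L (p * monom 1 m) = 0"
    using orth'[of "m + 1"] orth'[of m] by (simp add: twist_def) algebra
  then have c2: "coeff p (m + 2) = 0" unfolding L1 L2 by simp
  \<comment> \<open>The value of \<open>L\<close> at \<open>x^(2 * m + 5)\<close> enters with factor
    \<open>coeff p (m + 2)\<close>, which is zero by \<open>c2\<close>.\<close>
  have L3: "L (p * monom 1 (m + 3)) = coeff p m + a * coeff p (m + 1)"
    unfolding L_mult_monom[OF deg'] split c2 e L_top L_n L_n2 by (simp add: L_small)
  have "coeff p (m + 3) + (coeff p m + a * coeff p (m + 1)) * \<eta> = 0"
    using orth'[of m] by (simp add: twist_def L1 L3 mult.commute)
  then have c3: "coeff p (m + 3) = (coeff p m + a * coeff p (m + 1)) * \<eta>"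
    by (metis double add_right_imp_eq)
  show ?thesis by (rule sum_monom_twisted[OF deg' c2 c3])
qed

end

section \<open>Parameters, self-duality and TGRS form of the code\<close>

definition tspace :: "nat \<Rightarrow> 'a::field \<Rightarrow> 'a \<Rightarrow> 'a poly set" where
  "tspace m a \<eta> = {\<Sum>i<m+2. smult (f i) (tmonom m a \<eta> i) |f. True}"

text \<open>All polynomials involved have degree at most \<open>m + 3 < 2 * m + 4\<close>. Hence
  evaluation is injective on them, and distinct words differ in at least
  \<open>(2 * m + 4) - (m + 3) = m + 1\<close> positions.\<close>

lemma linear_code_tspace:
  fixes \<alpha> v :: "'a::field ^ 'n"
  assumes inj: "inj (($) \<alpha>)" and v: "\<And>i. v $ i \<noteq> 0" and n: "CARD('n) = 2 * m + 4"
  shows "linear_code (ev \<alpha> v ` tspace m a \<eta>) (2 * m + 4) (m + 2) (m + 1)"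
proof -
  let ?C = "ev \<alpha> v ` tspace m a \<eta>"
  let ?P = "\<lambda>f. \<Sum>i<m+2. smult (f i) (tmonom m a \<eta> i)"
  have P: "?P f \<in> tspace m a \<eta>" for f unfolding tspace_def by blast
  have C: "?C = {\<Sum>i<m+2. f i *s ev \<alpha> v (tmonom m a \<eta> i) |f. True}"
    unfolding tspace_def ev_sum_smult[symmetric] by blast
  have deg: "degree (?P f) < CARD('n)" for f
    using degree_sum_tmonom[of f m a \<eta>] n by linarith
  have indep: "f j = 0"
    if that: "(\<Sum>i<m+2. f i *s ev \<alpha> v (tmonom m a \<eta> i)) = 0" "j < m + 2" for f j
  proof -
    have "ev \<alpha> v (?P f) = ev \<alpha> v 0" 
      using that(1) unfolding ev_sum_smult by (simp only:) (simp add: ev_def vec_eq_iff)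
    then have "?P f = 0" using ev_eq_iff[OF inj v deg[of f], where q = 0] n by simp
    then show ?thesis using coeff_sum_tmonom[OF that(2), of f a \<eta>] by simp
  qed
  have sd: "vec.subspace ?C" "vec.dim ?C = m + 2"
    using dim_span_family[where w = "\<lambda>i. ev \<alpha> v (tmonom m a \<eta> i)" and k = "m + 2"] indep
    unfolding C by blast+
  have "m + 1 \<le> min_dist ?C"
  proof (rule min_dist_geI)
    \<comment> \<open>Since \<open>min_dist\<close> is 0 on a one-word code, two distinct words must
      be exhibited; their polynomials differ in the constant coefficient.\<close>
    show "ev \<alpha> v (?P (\<lambda>_. 1)) \<in> ?C" "ev \<alpha> v (?P (\<lambda>_. 0)) \<in> ?C"
      by (intro imageI P)+
    show "ev \<alpha> v (?P (\<lambda>_. 1)) \<noteq> ev \<alpha> v (?P (\<lambda>_. 0))"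
      unfolding ev_eq_iff[OF inj v deg deg]
      using coeff_sum_tmonom[of 0 m "\<lambda>_. 1" a \<eta>]
      by (auto simp del: sum.lessThan_Suc add_2_eq_Suc')
    fix x y assume "x \<in> ?C" "y \<in> ?C" "x \<noteq> y"
    then obtain p q where "x = ev \<alpha> v p" "y = ev \<alpha> v q" "p \<noteq> q"
      and mem: "p \<in> tspace m a \<eta>" "q \<in> tspace m a \<eta>" by blast
    moreover have "degree p \<le> m + 3" "degree q \<le> m + 3"
      using mem degree_sum_tmonom by (force simp only: tspace_def mem_Collect_eq)+
    ultimately show "m + 1 \<le> hamming_dist x y"
      using hamming_dist_ev[OF inj v, of p q "m + 3"] n by simp
  qed
  then show ?thesis using sd n by (simp add: linear_code_def)
qed

text \<open>Self-orthogonality follows from \<open>tmonom_orthogonal\<close> by bilinearity.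
  Conversely, every word comes from a polynomial of degree below the length, so
  \<open>orthogonal_imp_twisted\<close> puts each dual word in the code without a dimension
  count.\<close>

lemma self_dual_tspace:
  fixes \<alpha> v :: "'a::field ^ 'n"
  assumes inj: "inj (($) \<alpha>)" and v: "\<And>i. v $ i \<noteq> 0" and n: "CARD('n) = 2 * m + 4"
    and L: "twisted_functional (root_sum \<alpha> v) m a"
  shows "self_dual (ev \<alpha> v ` tspace m a \<eta>)"
proof -
  interpret twisted_functional "root_sum \<alpha> v" m a by (rule L)
  let ?P = "\<lambda>f. \<Sum>i<m+2. smult (f i) (tmonom m a \<eta> i)"
  have orth: "root_sum \<alpha> v (?P f * ?P f') = 0" for f f'
    by (simp add: sum_product L_sum L_smult tmonom_orthogonal del: sum.lessThan_Suc)
  have tm: "tmonom m a \<eta> j \<in> tspace m a \<eta>" if "j < m + 2" for j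
  proof -
    have "tmonom m a \<eta> j = ?P (\<lambda>i. if i = j then 1 else 0)"
      using that by (simp add: if_distrib[of "\<lambda>c. smult c _"] cong: if_cong)
    then show ?thesis unfolding tspace_def
      by (intro CollectI exI[of _ "\<lambda>i. if i = j then 1 else 0"] conjI TrueI)
  qed
  show ?thesis unfolding self_dual_def
  proof
    show "ev \<alpha> v ` tspace m a \<eta> \<subseteq> dual_code (ev \<alpha> v ` tspace m a \<eta>)"
      by (auto simp: dual_code_def tspace_def scalar_product_ev orth
          simp del: sum.lessThan_Suc add_2_eq_Suc')
    show "dual_code (ev \<alpha> v ` tspace m a \<eta>) \<subseteq> ev \<alpha> v ` tspace m a \<eta>"
    proof
      fix x assume x: "x \<in> dual_code (ev \<alpha> v ` tspace m a \<eta>)"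
      obtain p where p: "degree p < CARD('n)" "x = ev \<alpha> v p" using ev_surj[OF inj v] .
      have "root_sum \<alpha> v (p * tmonom m a \<eta> j) = 0" if "j < m + 2" for j
        using x tm[OF that] by (simp add: dual_code_def p scalar_product_ev)
      then have "p = ?P (coeff p)" using p n by (intro orthogonal_imp_twisted) auto
      then have "p \<in> tspace m a \<eta>" unfolding tspace_def by blast
      then show "x \<in> ev \<alpha> v ` tspace m a \<eta>" using p by blast
    qed
  qed
qed

text \<open>Only column 2 of the twist matrix is nonzero, because \<open>k - 1 + 2 = m + 3\<close>
  for \<open>k = m + 2\<close>. The shift \<open>i - 1\<close> reflects that matrix rows are
  numbered from 1.\<close>

lemma tspace_eq_tgrs_polys:
  "tspace m a \<eta> = tgrs_polys (2 * m + 4) (m + 2) (\<lambda>i j. if j = 2 then twist m a (i - 1) * \<eta> else 0)"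
proof -
  have "(\<Sum>j=1..m+2. monom (if j = 2 then twist m a i * \<eta> else 0) (m + 1 + j))
      = (\<Sum>j\<in>{2}. monom (twist m a i * \<eta>) (m + 1 + j))" for i
    by (rule sum.mono_neutral_cong_right) auto
  then show ?thesis
    by (simp add: tspace_def tgrs_polys_def tmonom_def smult_add_right sum.distrib smult_monom
        numeral_3_eq_3)
qed

section \<open>The polynomial \<open>g\<close> and the recurrence for its root sums\<close>

lemma
  fixes g :: "'a::field poly"
  assumes g: "g = monom 1 (2 * m + 4) + monom a (2 * m + 3) + monom b (2 * m + 2)
                + monom d (2 * m + 1) + monom c 0"
  shows degree_quintinomial: "degree g = 2 * m + 4"
    and lead_coeff_quintinomial: "lead_coeff g = 1"
proof -
  have "degree (monom a (2 * m + 3) + monom b (2 * m + 2) + monom d (2 * m + 1) + monom c 0)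
      \<le> 2 * m + 3"
    by (intro degree_add_le order_trans[OF degree_monom_le]) auto
  then show deg: "degree g = 2 * m + 4"
    unfolding g add.assoc by (subst degree_add_eq_left) (auto simp: degree_monom_eq)
  show "lead_coeff g = 1" unfolding deg by (simp add: g)
qed

text \<open>The recurrence comes from evaluating \<open>g(x) x\<^sup>j\<close> at the roots of \<open>g\<close>.\<close>

lemma twisted_functional_root_sum:
  fixes \<alpha> v :: "'a::field ^ 'n"
  assumes inj: "inj (($) \<alpha>)" and roots: "range (($) \<alpha>) = {x. poly g x = 0}"
    and n: "CARD('n) = 2 * m + 4" and two: "(2::'a) = 0"
    and v: "\<And>i. (v $ i)\<^sup>2 = inverse (poly (pderiv g) (\<alpha> $ i))"
    and g: "g = monom 1 (2 * m + 4) + monom a (2 * m + 3) + monom b (2 * m + 2)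
                + monom (a ^ 3) (2 * m + 1) + monom c 0"
  shows "twisted_functional (root_sum \<alpha> v) m a"
proof -
  note deg = degree_quintinomial[OF g] and lead = lead_coeff_quintinomial[OF g]
  define H where "H j = root_sum \<alpha> v (monom 1 j)" for j
  have low: "root_sum \<alpha> v p = coeff p (2 * m + 3)" if "degree p < 2 * m + 4" for p
    using root_sum_eq_coeff[OF inj roots lead _ v, of p] that deg by (simp add: n add.commute)
  have H0: "H j = 0" if "j < 2 * m + 3" for j
    unfolding H_def by (subst low) (use that in \<open>auto simp: degree_monom_eq\<close>)
  have H1: "H (2 * m + 3) = 1"
    unfolding H_def by (subst low) (auto simp: degree_monom_eq)
  have rec: "H (2 * m + 4 + j) + a * H (2 * m + 3 + j) + b * H (2 * m + 2 + j)
      + a ^ 3 * H (2 * m + 1 + j) + c * H j = 0" for j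
  proof -
    have "poly g (\<alpha> $ i) = 0" for i using roots by auto
    then have "root_sum \<alpha> v (g * monom 1 j) = 0" by (simp add: root_sum_def)
    then show ?thesis unfolding g H_def
      by (simp add: distrib_right mult_monom root_sum_add root_sum_monom[of _ _ a]
          root_sum_monom[of _ _ b] root_sum_monom[of _ _ c] root_sum_monom[of _ _ "a ^ 3"])
  qed
  have dbl: "x + x = (0::'a)" for x using two by (metis mult_2 mult_zero_left)
  have cancel: "x = y" if "x + y = 0" for x y :: 'a using that by (metis dbl add_right_imp_eq)
  \<comment> \<open>The exponents are kept free so that instances can be stated with normalised
    indices such as \<open>2 * m + 5\<close>.\<close>
  have rec': "H i\<^sub>4 + a * H i\<^sub>3 + b * H i\<^sub>2 + a ^ 3 * H i\<^sub>1 + c * H j = 0"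
    if "i\<^sub>4 = 2 * m + 4 + j" "i\<^sub>3 = 2 * m + 3 + j" "i\<^sub>2 = 2 * m + 2 + j" "i\<^sub>1 = 2 * m + 1 + j"
    for i\<^sub>1 i\<^sub>2 i\<^sub>3 i\<^sub>4 j
    using rec[of j] that by simp
  have H2: "H (2 * m + 4) = a"
  proof (rule cancel)
    show "H (2 * m + 4) + a = 0" using rec[of 0] by (simp add: H0 H1)
  qed
  have "H (2 * m + 5) + a * H (2 * m + 4) + b * H (2 * m + 3) + a ^ 3 * H (2 * m + 2) + c * H 1 = 0"
    by (rule rec') simp_all
  then have "H (2 * m + 5) + (a\<^sup>2 + b) = 0"
    unfolding H1 H2 by (simp add: H0 power2_eq_square add.assoc)
  then have H3: "H (2 * m + 5) = a\<^sup>2 + b" by (rule cancel)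
  have "H (2 * m + 6) + a * H (2 * m + 5) + b * H (2 * m + 4) + a ^ 3 * H (2 * m + 3) + c * H 2 = 0"
    by (rule rec') simp_all
  then have "H (2 * m + 6) + (a * (a\<^sup>2 + b) + b * a + a ^ 3) = 0"
    unfolding H1 H2 H3 by (simp add: H0 add.assoc)
  then have "H (2 * m + 6) = a * (a\<^sup>2 + b) + b * a + a ^ 3" by (rule cancel)
  \<comment> \<open>One copy of \<open>a ^ 3\<close> arises from the recurrence, the other is the
    coefficient of \<open>g\<close> at \<open>x^(2 * m + 1)\<close>; together with the doubled
    \<open>a * b\<close> everything cancels.\<close>
  also have "\<dots> = (a ^ 3 + a * b) + (a ^ 3 + a * b)"
    by (simp add: algebra_simps power2_eq_square power3_eq_cube)
  finally have H4: "H (2 * m + 6) = 0" by (simp only: dbl)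
  show ?thesis
    by unfold_locales (use two low H2 H4 in \<open>simp_all add: root_sum_add root_sum_smult H_def\<close>)
qed

section \<open>Characteristic 2 and the final assembly\<close>

text \<open>Translation by 1 permutes the field, so the sum of 1 over all elements, which is
  \<open>2 ^ h\<close> in the field, must vanish.\<close>

lemma two_eq_0_of_card:
  assumes "CARD('a::{field,finite}) = 2 ^ h"
  shows "(2::'a) = 0"
proof -
  have "(\<Sum>x\<in>UNIV. x + 1) = (\<Sum>x\<in>UNIV. x :: 'a)"
    by (rule sum.reindex_bij_witness[where i = "\<lambda>x. x - 1" and j = "\<lambda>x. x + 1"]) auto
  then have "of_nat (CARD('a)) = (0::'a)" by (simp add: sum.distrib)
  then show ?thesis by (simp add: assms)
qed

theorem theorem20:
  fixes s h t :: nat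
    and K :: "'a::finite_field set"
    and a b c \<eta>\<^sub>1 \<eta>\<^sub>2 :: 'a
    and g :: "'a poly"
    and \<alpha> v :: "'a ^ 'n"
    and S\<^sub>1 :: "'a poly set"
    and C\<^sub>1 :: "('a ^ 'n) set"
  assumes "s \<ge> 2" and "h > 0" and "t > 0" and "t dvd h" and "s \<le> h"
    and "CARD('a) = 2 ^ h"
    and "is_subfield K" and "card K = 2 ^ t"
    and "a \<in> K" and "b \<in> K" and "c \<in> K"
    and "a \<noteq> 0" and "b \<noteq> 0" and "c \<noteq> 0"
    and "g = monom 1 (2 ^ s) + monom a (2 ^ s - 1) + monom b (2 ^ s - 2)
             + monom (a ^ 3) (2 ^ s - 3) + monom c 0"
    and "splitting_field_over K g"
    and "CARD('n) = 2 ^ s"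
    and "range (($) \<alpha>) = {x. poly g x = 0}" and "inj (($) \<alpha>)"
    and "v = (\<chi> i. inverse (a ^ (2 ^ (h - 1)) * (\<alpha> $ i) ^ (2 ^ (s - 1) - 1)
                            + a ^ (3 * 2 ^ (h - 1)) * (\<alpha> $ i) ^ (2 ^ (s - 1) - 2)))"
    and "\<eta>\<^sub>1 \<noteq> 0" and "\<eta>\<^sub>2 = a * \<eta>\<^sub>1"
    and "S\<^sub>1 = {(\<Sum>i=0..2 ^ (s - 1) - 1. monom (f i) i)
               + monom ((f (2 ^ (s - 1) - 2) + a * f (2 ^ (s - 1) - 1)) * \<eta>\<^sub>1) (2 ^ (s - 1) + 1)
               | f. True}"
    and "C\<^sub>1 = ev \<alpha> v ` S\<^sub>1"
  shows "linear_code C\<^sub>1 (2 ^ s) (2 ^ (s - 1)) (2 ^ (s - 1) - 1)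
         \<and> self_dual C\<^sub>1
         \<and> is_tgrs_code (2 ^ (s - 1)) \<alpha> v C\<^sub>1"
proof -
  define m where "m = (2::nat) ^ (s - 1) - 2"
  have "(2::nat) ^ 1 \<le> 2 ^ (s - 1)" using assms(1) by (intro power_increasing) auto
  then have k: "2 ^ (s - 1) = m + 2" by (simp add: m_def)
  have "(2::nat) ^ s = 2 * 2 ^ (s - 1)" using assms(1) by (cases s) auto
  then have n: "2 ^ s = 2 * m + 4" using k by simp
  have exps: "2 * m + 4 - 1 = 2 * m + 3" "2 * m + 4 - 2 = 2 * m + 2" "2 * m + 4 - 3 = 2 * m + 1"
    "m + 2 - 1 = m + 1" "m + 2 - 2 = m" by simp_all
  note card = assms(6) and inj = assms(19) and roots = assms(18)
  have cn: "CARD('n) = 2 * m + 4" using assms(17) n by simp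
  have g: "g = monom 1 (2 * m + 4) + monom a (2 * m + 3) + monom b (2 * m + 2)
                + monom (a ^ 3) (2 * m + 1) + monom c 0"
    using assms(15) unfolding n exps .
  have two: "(2::'a) = 0" using two_eq_0_of_card[OF card] .
  \<comment> \<open>The square root of \<open>a\<close>, as \<open>a ^ (2 ^ h) = a\<close> in a
    field with \<open>2 ^ h\<close> elements; the second coefficient in \<open>v\<close> is then
    \<open>r ^ 3\<close>.\<close>
  define r where "r = a ^ (2 ^ (h - 1))"
  have r: "r\<^sup>2 = a"
  proof -
    have "r\<^sup>2 = a ^ (2 ^ h)"
      using assms(2) by (simp add: r_def flip: power_mult power_Suc2)
    then show ?thesis using finite_field_power_card_eq_same[of a] card by simp
  qed
  have "a ^ (3 * 2 ^ (h - 1)) = r ^ 3" by (simp add: r_def mult.commute flip: power_mult)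
  then have vi: "v $ i = inverse (r * (\<alpha> $ i) ^ (m + 1) + r ^ 3 * (\<alpha> $ i) ^ m)" for i
    using assms(20) unfolding k exps by (simp add: r_def)
  \<comment> \<open>Only the odd powers of x in \<open>g\<close> survive differentiation, leaving
    two squares; their sum is a square in characteristic 2.\<close>
  have dg: "poly (pderiv g) x = (r * x ^ (m + 1) + r ^ 3 * x ^ m)\<^sup>2" for x
  proof -
    have "poly (pderiv g) x = a * x ^ (2 * m + 2) + a ^ 3 * x ^ (2 * m)"
    proof -
      have ofs: "of_nat (2 * m + 4) = (0::'a)" "of_nat (2 * m + 2) = (0::'a)"
        "of_nat (2 * m + 3) = (1::'a)" "of_nat (2 * m + 1) = (1::'a)"
        using two by (simp_all add: numeral_eq_Suc)
      have exps: "2 * m + 4 - 1 = 2 * m + 3" "2 * m + 3 - 1 = 2 * m + 2"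
        "2 * m + 2 - 1 = 2 * m + 1" "2 * m + 1 - 1 = 2 * m" by simp_all
      show ?thesis
        unfolding g pderiv_add pderiv_monom ofs exps by (simp add: poly_monom)
    qed
    also have "\<dots> = (r * x ^ (m + 1))\<^sup>2 + (r ^ 3 * x ^ m)\<^sup>2"
    proof -
      have "x ^ (2 * m + 2) = (x ^ (m + 1))\<^sup>2" "x ^ (2 * m) = (x ^ m)\<^sup>2" "a ^ 3 = (r ^ 3)\<^sup>2"
        by (simp_all only: power_mult[symmetric] r[symmetric])
          (simp_all add: algebra_simps)
      then show ?thesis by (simp only: power_mult_distrib r)
    qed
    also have "\<dots> = (r * x ^ (m + 1) + r ^ 3 * x ^ m)\<^sup>2"
      unfolding power2_sum two by simp
    finally show ?thesis .
  qed
  have v2: "(v $ i)\<^sup>2 = inverse (poly (pderiv g) (\<alpha> $ i))" for i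
    by (simp add: vi dg power_inverse)
  have L: "twisted_functional (root_sum \<alpha> v) m a"
    using twisted_functional_root_sum[OF inj roots cn two v2 g] .
  \<comment> \<open>As \<open>inverse 0 = 0\<close>, this needs an argument: the roots of
    \<open>g\<close> are simple, so its derivative does not vanish at them.\<close>
  have v: "v $ i \<noteq> 0" for i
  proof -
    have "card {x. poly g x = 0} = degree g"
      using card_image[OF inj] roots cn degree_quintinomial[OF g] by simp
    moreover have "poly g (\<alpha> $ i) = 0" using roots by auto
    ultimately have "poly (pderiv g) (\<alpha> $ i) \<noteq> 0"
      by (rule poly_pderiv_root_nonzero[OF lead_coeff_quintinomial[OF g]])
    then show ?thesis using v2[of i] by auto
  qed
  have "S\<^sub>1 = tspace m a \<eta>\<^sub>1"
  proof -
    have "{0..m + 1} = {..<m+2}" by auto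
    then show ?thesis
      using assms(23) unfolding k exps tspace_def sum_tmonom by (simp add: numeral_3_eq_3)
  qed
  then have C: "C\<^sub>1 = ev \<alpha> v ` tspace m a \<eta>\<^sub>1" using assms(24) by simp
  have "is_tgrs_code (m + 2) \<alpha> v C\<^sub>1"
    unfolding is_tgrs_code_def using inj v cn C tspace_eq_tgrs_polys[of m a \<eta>\<^sub>1] by auto
  then show ?thesis
    using linear_code_tspace[OF inj v cn, of a \<eta>\<^sub>1] self_dual_tspace[OF inj v cn L]
    unfolding n k C by simp
qed

end
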